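(* Let $G$ be a group. (a) If $G$ is fully left-orderable, then the Identity Problem and the Left-Order Extension Problem for $G$ are complements: a finite subset $S$ of $G$ extends to a left-order on $G$ if and only if $e_G\notin S^+$. (b) If $G$ is fully bi-orderable, then the Normal Identity Problem and the Bi-Order Extension Problem for $G$ are complements: a finite subset $S$ of $G$ extends to a bi-order on $G$ if and only if $e_G\notin S^\circ$.
   Context: Let $G$ be a group with identity $e_G$. A partial left-order on $G$ is a partial order $\le$ on $G$ such that $a\le b$ implies $ca\le cb$ for all $a,b,c\in G$; a partial bi-order is one such that $a\le b$ implies $cad\le cbd$ for all $a,b,c,d\in G$. If total, these are called a left-order, respectively a bi-order. The positive cone of $\le$ is $\{a\in G\mid e_G<a\}$; an order is identified with its positive cone, and a subset of $G$ (or an order) extends to an order if it (or its positive cone) is contained in the positive cone of the latter. $G$ is fully left-orderable (fully bi-orderable) if every partial left-order (partial bi-order) on $G$ extends to a left-order (bi-order) on $G$. For $S\subseteq G$, $S^+$ is the subsemigroup generated by $S$, and $S^\circ$ is the normal subsemigroup generated by $S$ (the smallest subsemigroup containing $S$ and closed under conjugation by elements of $G$); both are empty if $S=\emptyset$. The Identity Problem (Normal Identity Problem) asks, for a given finite $S\subseteq G$, whether $e_G\in S^+$ ($e_G\in S^\circ$). The Left-Order (Bi-Order) Extension Problem asks whether a given finite $S\subseteq G$ extends to a left-order (bi-order) on $G$. *)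

theory Defs
  imports "HOL-Algebra.Group" "HOL.Hull"
begin

definition partial_left_order :: "('a, 'b) monoid_scheme \<Rightarrow> 'a rel \<Rightarrow> bool" where
  "partial_left_order G r \<longleftrightarrow>
     partial_order_on (carrier G) r \<and>
     (\<forall>a\<in>carrier G. \<forall>b\<in>carrier G. \<forall>c\<in>carrier G.
        (a, b) \<in> r \<longrightarrow> (c \<otimes>\<^bsub>G\<^esub> a, c \<otimes>\<^bsub>G\<^esub> b) \<in> r)"

definition partial_bi_order :: "('a, 'b) monoid_scheme \<Rightarrow> 'a rel \<Rightarrow> bool" where
  "partial_bi_order G r \<longleftrightarrow>
     partial_order_on (carrier G) r \<and>
     (\<forall>a\<in>carrier G. \<forall>b\<in>carrier G. \<forall>c\<in>carrier G. \<forall>d\<in>carrier G.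
        (a, b) \<in> r \<longrightarrow> (c \<otimes>\<^bsub>G\<^esub> a \<otimes>\<^bsub>G\<^esub> d, c \<otimes>\<^bsub>G\<^esub> b \<otimes>\<^bsub>G\<^esub> d) \<in> r)"

definition left_order :: "('a, 'b) monoid_scheme \<Rightarrow> 'a rel \<Rightarrow> bool" where
  "left_order G r \<longleftrightarrow> partial_left_order G r \<and> total_on (carrier G) r"

definition bi_order :: "('a, 'b) monoid_scheme \<Rightarrow> 'a rel \<Rightarrow> bool" where
  "bi_order G r \<longleftrightarrow> partial_bi_order G r \<and> total_on (carrier G) r"

definition positive_cone :: "('a, 'b) monoid_scheme \<Rightarrow> 'a rel \<Rightarrow> 'a set" where
  "positive_cone G r = {a \<in> carrier G. (\<one>\<^bsub>G\<^esub>, a) \<in> r \<and> a \<noteq> \<one>\<^bsub>G\<^esub>}"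

definition extends_to_left_order :: "('a, 'b) monoid_scheme \<Rightarrow> 'a set \<Rightarrow> bool" where
  "extends_to_left_order G S \<longleftrightarrow> (\<exists>r. left_order G r \<and> S \<subseteq> positive_cone G r)"

definition extends_to_bi_order :: "('a, 'b) monoid_scheme \<Rightarrow> 'a set \<Rightarrow> bool" where
  "extends_to_bi_order G S \<longleftrightarrow> (\<exists>r. bi_order G r \<and> S \<subseteq> positive_cone G r)"

definition fully_left_orderable :: "('a, 'b) monoid_scheme \<Rightarrow> bool" where
  "fully_left_orderable G \<longleftrightarrow>
     (\<forall>r. partial_left_order G r \<longrightarrow> extends_to_left_order G (positive_cone G r))"

definition fully_bi_orderable :: "('a, 'b) monoid_scheme \<Rightarrow> bool" where
  "fully_bi_orderable G \<longleftrightarrow>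
     (\<forall>r. partial_bi_order G r \<longrightarrow> extends_to_bi_order G (positive_cone G r))"

text \<open>The empty set counts as a (normal) subsemigroup, so that the hull of the empty set
  is empty.\<close>

definition subsemigroup :: "('a, 'b) monoid_scheme \<Rightarrow> 'a set \<Rightarrow> bool" where
  "subsemigroup G H \<longleftrightarrow>
     H \<subseteq> carrier G \<and> (\<forall>x\<in>H. \<forall>y\<in>H. x \<otimes>\<^bsub>G\<^esub> y \<in> H)"

definition normal_subsemigroup :: "('a, 'b) monoid_scheme \<Rightarrow> 'a set \<Rightarrow> bool" where
  "normal_subsemigroup G H \<longleftrightarrow>
     subsemigroup G H \<and>
     (\<forall>g\<in>carrier G. \<forall>x\<in>H. g \<otimes>\<^bsub>G\<^esub> x \<otimes>\<^bsub>G\<^esub> inv\<^bsub>G\<^esub> g \<in> H)"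

definition subsemigroup_generated :: "('a, 'b) monoid_scheme \<Rightarrow> 'a set \<Rightarrow> 'a set" where
  "subsemigroup_generated G S = subsemigroup G hull S"

definition normal_subsemigroup_generated :: "('a, 'b) monoid_scheme \<Rightarrow> 'a set \<Rightarrow> 'a set" where
  "normal_subsemigroup_generated G S = normal_subsemigroup G hull S"

text \<open>A decision problem is identified with the set of its positive instances.\<close>

definition instances :: "('a, 'b) monoid_scheme \<Rightarrow> 'a set set" where
  "instances G = {S. finite S \<and> S \<subseteq> carrier G}"

definition identity_problem :: "('a, 'b) monoid_scheme \<Rightarrow> 'a set set" where
  "identity_problem G = {S \<in> instances G. \<one>\<^bsub>G\<^esub> \<in> subsemigroup_generated G S}"

definition normal_identity_problem :: "('a, 'b) monoid_scheme \<Rightarrow> 'a set set" where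
  "normal_identity_problem G = {S \<in> instances G. \<one>\<^bsub>G\<^esub> \<in> normal_subsemigroup_generated G S}"

definition left_order_extension_problem :: "('a, 'b) monoid_scheme \<Rightarrow> 'a set set" where
  "left_order_extension_problem G = {S \<in> instances G. extends_to_left_order G S}"

definition bi_order_extension_problem :: "('a, 'b) monoid_scheme \<Rightarrow> 'a set set" where
  "bi_order_extension_problem G = {S \<in> instances G. extends_to_bi_order G S}"

end

theory Submission
  imports Defs
begin

text \<open>Positive cones of partial left-orders (bi-orders) are exactly the (normal) subsemigroups
  avoiding the identity: such a subsemigroup \<open>P\<close> is the cone of the relation
  \<open>a < b \<longleftrightarrow> a\<inverse>b \<in> P\<close>. Hence the subsemigroup generated by \<open>S\<close> avoids
  the identity iff \<open>S\<close> lies in the cone of some partial order, and over a fully orderable group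
  every such cone lies in the cone of a total order.\<close>

text \<open>A cone avoiding the identity only encodes the strict order, so the diagonal is added by
  hand. The quotient \<open>inv a \<otimes> b\<close>, not \<open>b \<otimes> inv a\<close>, is the
  one unchanged by left translation.\<close>

definition order_of_cone :: "('a, 'b) monoid_scheme \<Rightarrow> 'a set \<Rightarrow> 'a rel" where
  "order_of_cone G P =
     {(a, b). a \<in> carrier G \<and> b \<in> carrier G \<and> (a = b \<or> inv\<^bsub>G\<^esub> a \<otimes>\<^bsub>G\<^esub> b \<in> P)}"

text \<open>The universal property of the hull. Taking \<open>H\<close> to be a positive cone bounds
  the hull by it; taking \<open>H\<close> to be the hull itself yields that the hull contains
  \<open>S\<close>.\<close>

lemma subsemigroup_generated_subset_iff:
  assumes "subsemigroup G H"
  shows "subsemigroup_generated G S \<subseteq> H \<longleftrightarrow> S \<subseteq> H"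
  unfolding subsemigroup_generated_def
  using assms by (meson hull_minimal hull_subset order_trans)

lemma normal_subsemigroup_generated_subset_iff:
  assumes "normal_subsemigroup G H"
  shows "normal_subsemigroup_generated G S \<subseteq> H \<longleftrightarrow> S \<subseteq> H"
  unfolding normal_subsemigroup_generated_def
  using assms by (meson hull_minimal hull_subset order_trans)

context group
begin

lemma mult_inv_cancel_left:
  assumes "x \<in> carrier G" "y \<in> carrier G"
  shows "x \<otimes> (inv x \<otimes> y) = y" "inv x \<otimes> (x \<otimes> y) = y"
  using assms by (simp_all flip: m_assoc)

text \<open>An intersection of subsemigroups is closed under products. To lie inside the carrier it
  needs at least one member in the family, and \<open>carrier G\<close> itself is one.\<close>

lemma subsemigroup_subsemigroup_generated:
  assumes "S \<subseteq> carrier G"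
  shows "subsemigroup G (subsemigroup_generated G S)"
proof -
  have "subsemigroup G (carrier G)"
    by (simp add: subsemigroup_def)
  with assms have "subsemigroup_generated G S \<subseteq> carrier G"
    by (simp add: subsemigroup_generated_subset_iff)
  then show ?thesis
    by (simp add: subsemigroup_def subsemigroup_generated_def hull_def)
qed

lemma normal_subsemigroup_normal_subsemigroup_generated:
  assumes "S \<subseteq> carrier G"
  shows "normal_subsemigroup G (normal_subsemigroup_generated G S)"
proof -
  have "normal_subsemigroup G (carrier G)"
    by (simp add: normal_subsemigroup_def subsemigroup_def)
  with assms have "normal_subsemigroup_generated G S \<subseteq> carrier G"
    by (simp add: normal_subsemigroup_generated_subset_iff)
  then show ?thesis
    by (simp add: normal_subsemigroup_def subsemigroup_def normal_subsemigroup_generated_def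
        hull_def)
qed

lemma partial_bi_order_imp_partial_left_order:
  assumes "partial_bi_order G r"
  shows "partial_left_order G r"
  unfolding partial_left_order_def
proof (intro conjI ballI impI)
  show "partial_order_on (carrier G) r"
    using assms by (simp add: partial_bi_order_def)
  fix a b c
  assume "a \<in> carrier G" "b \<in> carrier G" "c \<in> carrier G" "(a, b) \<in> r"
  then have "(c \<otimes> a \<otimes> \<one>, c \<otimes> b \<otimes> \<one>) \<in> r"
    using assms by (simp only: partial_bi_order_def one_closed)
  then show "(c \<otimes> a, c \<otimes> b) \<in> r"
    using \<open>a \<in> carrier G\<close> \<open>b \<in> carrier G\<close> \<open>c \<in> carrier G\<close> by simp
qed

text \<open>Translating \<open>\<one> \<le> y\<close> by \<open>x\<close> on the left gives
  \<open>\<one> < x \<le> x \<otimes> y\<close>.\<close>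

lemma subsemigroup_positive_cone:
  assumes "partial_left_order G r"
  shows "subsemigroup G (positive_cone G r)"
  unfolding subsemigroup_def
proof (intro conjI ballI)
  show "positive_cone G r \<subseteq> carrier G"
    by (auto simp: positive_cone_def)
  have tr: "trans r" and as: "antisym r"
    using assms by (auto simp: partial_left_order_def partial_order_on_def preorder_on_def)
  fix x y
  assume "x \<in> positive_cone G r" "y \<in> positive_cone G r"
  then have x: "x \<in> carrier G" "(\<one>, x) \<in> r" "x \<noteq> \<one>"
    and y: "y \<in> carrier G" "(\<one>, y) \<in> r"
    by (auto simp: positive_cone_def)
  have "(x \<otimes> \<one>, x \<otimes> y) \<in> r"
    using assms x(1) y by (simp only: partial_left_order_def one_closed)
  then have le: "(x, x \<otimes> y) \<in> r"
    using x by simp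
  then have "(\<one>, x \<otimes> y) \<in> r"
    using x(2) transD[OF tr] by blast
  \<comment> \<open>Otherwise \<open>x \<le> \<one> \<le> x\<close>, and antisymmetry forces
    \<open>x = \<one>\<close>.\<close>
  moreover have "x \<otimes> y \<noteq> \<one>"
    using le x(2,3) antisymD[OF as] by metis
  ultimately show "x \<otimes> y \<in> positive_cone G r"
    using x y by (simp add: positive_cone_def)
qed

text \<open>Conjugation is a two-sided translation that fixes the identity, and it is injective, so
  strict positivity survives.\<close>

lemma normal_subsemigroup_positive_cone:
  assumes "partial_bi_order G r"
  shows "normal_subsemigroup G (positive_cone G r)"
  unfolding normal_subsemigroup_def
proof (intro conjI ballI)
  show "subsemigroup G (positive_cone G r)"
    using assms by (intro subsemigroup_positive_cone partial_bi_order_imp_partial_left_order)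
  fix g x
  assume g: "g \<in> carrier G" and "x \<in> positive_cone G r"
  then have x: "x \<in> carrier G" "(\<one>, x) \<in> r" "x \<noteq> \<one>"
    by (auto simp: positive_cone_def)
  have "(g \<otimes> \<one> \<otimes> inv g, g \<otimes> x \<otimes> inv g) \<in> r"
    using assms g x by (simp only: partial_bi_order_def one_closed inv_closed)
  moreover have "g \<otimes> x \<otimes> inv g \<noteq> \<one>"
    using g x by (simp add: inv_solve_right')
  ultimately show "g \<otimes> x \<otimes> inv g \<in> positive_cone G r"
    using g x by (simp add: positive_cone_def)
qed

lemma positive_cone_order_of_cone:
  assumes "P \<subseteq> carrier G" "\<one> \<notin> P"
  shows "positive_cone G (order_of_cone G P) = P"
  using assms by (auto simp: positive_cone_def order_of_cone_def)

text \<open>Closure under products gives transitivity, absence of the identity gives antisymmetry,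
  and cancellation in the quotient gives left invariance.\<close>

lemma partial_left_order_order_of_cone:
  assumes P: "subsemigroup G P" and one: "\<one> \<notin> P"
  shows "partial_left_order G (order_of_cone G P)"
proof -
  have mult: "x \<otimes> y \<in> P" if "x \<in> P" "y \<in> P" for x y
    using P that by (simp add: subsemigroup_def)
  \<comment> \<open>Transitivity of the strict relation: the quotients telescope, the inner
    \<open>b \<otimes> inv b\<close> cancelling.\<close>
  have chain: "inv a \<otimes> c \<in> P"
    if "a \<in> carrier G" "b \<in> carrier G" "c \<in> carrier G" "inv a \<otimes> b \<in> P" "inv b \<otimes> c \<in> P"
    for a b c
  proof -
    have "inv a \<otimes> c = (inv a \<otimes> b) \<otimes> (inv b \<otimes> c)"
      using that(1-3) by (simp add: m_assoc mult_inv_cancel_left)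
    then show ?thesis
      using mult that(4,5) by simp
  qed
  have "antisym (order_of_cone G P)"
  proof (rule antisymI, rule ccontr)
    fix a b
    assume "(a, b) \<in> order_of_cone G P" "(b, a) \<in> order_of_cone G P" "a \<noteq> b"
    \<comment> \<open>Closing the chain at its starting point puts the identity into
      \<open>P\<close>.\<close>
    then have "a \<in> carrier G" "inv a \<otimes> a \<in> P"
      using chain[of a b a] by (auto simp: order_of_cone_def)
    then show False
      using one by simp
  qed
  moreover have "trans (order_of_cone G P)"
    by (rule transI) (use chain in \<open>auto simp: order_of_cone_def\<close>)
  moreover have "inv (c \<otimes> a) \<otimes> (c \<otimes> b) = inv a \<otimes> b"
    if "a \<in> carrier G" "b \<in> carrier G" "c \<in> carrier G" for a b c
    using that by (simp add: inv_mult_group m_assoc mult_inv_cancel_left)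
  ultimately show ?thesis
    by (auto simp: partial_left_order_def partial_order_on_def preorder_on_def refl_on_def
        order_of_cone_def)
qed

text \<open>Left invariance is inherited; normality supplies right invariance, since translating by
  \<open>d\<close> on the right conjugates the quotient \<open>inv a \<otimes> b\<close> by
  \<open>inv d\<close>.\<close>

lemma partial_bi_order_order_of_cone:
  assumes P: "normal_subsemigroup G P" and one: "\<one> \<notin> P"
  shows "partial_bi_order G (order_of_cone G P)"
  unfolding partial_bi_order_def
proof (intro conjI ballI impI)
  have left: "partial_left_order G (order_of_cone G P)"
    using P one by (intro partial_left_order_order_of_cone) (simp add: normal_subsemigroup_def)
  then show "partial_order_on (carrier G) (order_of_cone G P)"
    by (simp add: partial_left_order_def)
  fix a b c d
  assume a: "a \<in> carrier G" and b: "b \<in> carrier G" and c: "c \<in> carrier G" and d: "d \<in> carrier G"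
    and "(a, b) \<in> order_of_cone G P"
  then consider "a = b" | "inv a \<otimes> b \<in> P"
    by (auto simp: order_of_cone_def)
  then have "(a \<otimes> d, b \<otimes> d) \<in> order_of_cone G P"
  proof cases
    case 2
    then have "inv d \<otimes> (inv a \<otimes> b) \<otimes> inv (inv d) \<in> P"
      using P d inv_closed[OF d] unfolding normal_subsemigroup_def by blast
    moreover have "inv d \<otimes> (inv a \<otimes> b) \<otimes> inv (inv d) = inv (a \<otimes> d) \<otimes> (b \<otimes> d)"
      using a b d by (simp add: inv_mult_group m_assoc)
    ultimately show ?thesis
      using a b d by (simp add: order_of_cone_def)
  qed (use b d in \<open>simp add: order_of_cone_def\<close>)
  \<comment> \<open>The right translation is done, so left invariance applies to the pair of
    products with \<open>d\<close>.\<close>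
  then have "(c \<otimes> (a \<otimes> d), c \<otimes> (b \<otimes> d)) \<in> order_of_cone G P"
    using left a b c d by (simp add: partial_left_order_def)
  then show "(c \<otimes> a \<otimes> d, c \<otimes> b \<otimes> d) \<in> order_of_cone G P"
    using a b c d by (simp add: m_assoc)
qed

lemma extends_to_left_order_iff:
  assumes full: "fully_left_orderable G" and S: "S \<subseteq> carrier G"
  shows "extends_to_left_order G S \<longleftrightarrow> \<one> \<notin> subsemigroup_generated G S"
proof
  assume "extends_to_left_order G S"
  then obtain r where "partial_left_order G r" "S \<subseteq> positive_cone G r"
    by (auto simp: extends_to_left_order_def left_order_def)
  then have "subsemigroup_generated G S \<subseteq> positive_cone G r"
    by (simp add: subsemigroup_generated_subset_iff subsemigroup_positive_cone)
  then show "\<one> \<notin> subsemigroup_generated G S"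
    by (auto simp: positive_cone_def)
next
  let ?P = "subsemigroup_generated G S"
  assume one: "\<one> \<notin> ?P"
  have P: "subsemigroup G ?P"
    using S by (rule subsemigroup_subsemigroup_generated)
  \<comment> \<open>Full orderability speaks of cones of partial orders, so \<open>?P\<close> is
    first exhibited as such a cone.\<close>
  then have "positive_cone G (order_of_cone G ?P) = ?P"
    using one by (simp add: positive_cone_order_of_cone subsemigroup_def)
  then have "extends_to_left_order G ?P"
    using full partial_left_order_order_of_cone[OF P one]
    unfolding fully_left_orderable_def by metis
  moreover have "S \<subseteq> ?P"
    using P subsemigroup_generated_subset_iff by blast
  ultimately show "extends_to_left_order G S"
    unfolding extends_to_left_order_def by blast
qed

lemma extends_to_bi_order_iff:
  assumes full: "fully_bi_orderable G" and S: "S \<subseteq> carrier G"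
  shows "extends_to_bi_order G S \<longleftrightarrow> \<one> \<notin> normal_subsemigroup_generated G S"
proof
  assume "extends_to_bi_order G S"
  then obtain r where "partial_bi_order G r" "S \<subseteq> positive_cone G r"
    by (auto simp: extends_to_bi_order_def bi_order_def)
  \<comment> \<open>The cone of a bi-order is one of the normal subsemigroups over which the hull is
    the intersection.\<close>
  then have "normal_subsemigroup_generated G S \<subseteq> positive_cone G r"
    by (simp add: normal_subsemigroup_generated_subset_iff normal_subsemigroup_positive_cone)
  then show "\<one> \<notin> normal_subsemigroup_generated G S"
    by (auto simp: positive_cone_def)
next
  let ?P = "normal_subsemigroup_generated G S"
  assume one: "\<one> \<notin> ?P"
  have P: "normal_subsemigroup G ?P"
    using S by (rule normal_subsemigroup_normal_subsemigroup_generated)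
  then have "positive_cone G (order_of_cone G ?P) = ?P"
    using one by (simp add: positive_cone_order_of_cone normal_subsemigroup_def subsemigroup_def)
  then have "extends_to_bi_order G ?P"
    using full partial_bi_order_order_of_cone[OF P one]
    unfolding fully_bi_orderable_def by metis
  moreover have "S \<subseteq> ?P"
    using P normal_subsemigroup_generated_subset_iff by blast
  ultimately show "extends_to_bi_order G S"
    unfolding extends_to_bi_order_def by blast
qed

end

theorem proposition2:
  fixes G :: "('a, 'b) monoid_scheme"
  assumes "group G"
  shows "(fully_left_orderable G \<longrightarrow>
            left_order_extension_problem G = instances G - identity_problem G \<and>
            (\<forall>S. finite S \<and> S \<subseteq> carrier G \<longrightarrow>
               (extends_to_left_order G S \<longleftrightarrow> \<one>\<^bsub>G\<^esub> \<notin> subsemigroup_generated G S))) \<and>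
         (fully_bi_orderable G \<longrightarrow>
            bi_order_extension_problem G = instances G - normal_identity_problem G \<and>
            (\<forall>S. finite S \<and> S \<subseteq> carrier G \<longrightarrow>
               (extends_to_bi_order G S \<longleftrightarrow> \<one>\<^bsub>G\<^esub> \<notin> normal_subsemigroup_generated G S)))"
  \<comment> \<open>Once the problems are unfolded to sets of finite instances, being complements
    within \<open>instances G\<close> is the pointwise equivalence.\<close>
  using group.extends_to_left_order_iff[OF assms] group.extends_to_bi_order_iff[OF assms]
  by (auto simp: left_order_extension_problem_def identity_problem_def
      bi_order_extension_problem_def normal_identity_problem_def instances_def)

end
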